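(* $Q^{a}(\mathrm{Lin}_{k},u)=\Omega(k\log n)$ whenever $n\le u\le\exp(n^{1/(7k)})$.
   Context: Boolean functions are maps $f:\mathbb{Z}_2^n\to\mathbb{Z}_2$; $f$ is $\epsilon$-far from a family $\mathcal{P}$ if $|\{x:f(x)\ne g(x)\}|\ge\epsilon2^n$ for all $g\in\mathcal{P}$. A $u$-sample $q$-query $\epsilon$-tester for $\mathcal{P}$ is a randomized algorithm that, given a set $U\subseteq\mathbb{Z}_2^n$ of $u$ points drawn uniformly at random, queries an unknown $f$ on $q$ inputs from $U$, accepts with probability $\ge2/3$ if $f\in\mathcal{P}$ and rejects with probability $\ge2/3$ if $f$ is $\epsilon$-far from $\mathcal{P}$; $Q^a_\epsilon(\mathcal{P},u)$ is the minimal such $q$. $\epsilon$ is a fixed small constant (e.g. $0.001$) omitted from notation; asymptotics as $n\to\infty$; logarithms base 2. $\mathrm{Lin}_k$ is the family of functions $f(x)=x_{i_1}+\cdots+x_{i_k}$ over $\mathbb{Z}_2$ with distinct $i_1,\dots,i_k\in[n]$. *)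

theory Defs
  imports
    "HOL-Probability.Probability_Mass_Function"
    "HOL-Library.Z2"
    "HOL-Library.FuncSet"
    "HOL-Library.Extended_Real"
begin

text \<open>The field with two elements is \<^typ>\<open>bit\<close>. Points of the cube and Boolean functions are kept
  extensional, so that equality of points and of functions is the intended one.\<close>

type_synonym point = "nat \<Rightarrow> bit"
type_synonym boolfun = "point \<Rightarrow> bit"

definition cube :: "nat \<Rightarrow> point set" where
  "cube n = {0..<n} \<rightarrow>\<^sub>E UNIV"

definition boolfuns :: "nat \<Rightarrow> boolfun set" where
  "boolfuns n = cube n \<rightarrow>\<^sub>E UNIV"

definition Lin :: "nat \<Rightarrow> nat \<Rightarrow> boolfun set" where
  "Lin n k = {(\<lambda>x\<in>cube n. \<Sum>i\<in>I. x i) | I. I \<subseteq> {0..<n} \<and> card I = k}"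

definition far :: "nat \<Rightarrow> real \<Rightarrow> boolfun set \<Rightarrow> boolfun \<Rightarrow> bool" where
  "far n \<epsilon> P f \<longleftrightarrow> (\<forall>g\<in>P. real (card {x \<in> cube n. f x \<noteq> g x}) \<ge> \<epsilon> * 2 ^ n)"

text \<open>A deterministic, possibly adaptive, query algorithm is a decision tree. In \<open>Query x t0 t1\<close> the
  computation continues with \<open>t0\<close> if the queried value is \<open>0\<close> and with \<open>t1\<close> if it is \<open>1\<close>. The verdict
  \<^const>\<open>True\<close> means acceptance.\<close>

datatype (queries: 'a) dtree = Verdict bool | Query 'a "'a dtree" "'a dtree"

primrec run :: "'a dtree \<Rightarrow> ('a \<Rightarrow> bit) \<Rightarrow> bool" where
  "run (Verdict b) f = b"
| "run (Query x t0 t1) f = (if f x = 0 then run t0 f else run t1 f)"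

primrec depth :: "'a dtree \<Rightarrow> nat" where
  "depth (Verdict b) = 0"
| "depth (Query x t0 t1) = Suc (max (depth t0) (depth t1))"

text \<open>A randomized algorithm maps the sample \<open>U\<close> to a probability distribution on decision trees. The
  sample is uniform among the \<open>u\<close>-element subsets of the cube, which is meaningful only for
  \<open>u \<le> 2 ^ n\<close>.\<close>

definition samples :: "nat \<Rightarrow> nat \<Rightarrow> point set set" where
  "samples n u = {U. U \<subseteq> cube n \<and> card U = u}"

definition outcome :: "nat \<Rightarrow> nat \<Rightarrow> (point set \<Rightarrow> point dtree pmf) \<Rightarrow> boolfun \<Rightarrow> bool pmf" where
  "outcome n u A f =
     bind_pmf (pmf_of_set (samples n u)) (\<lambda>U. map_pmf (\<lambda>t. run t f) (A U))"

definition is_tester ::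
  "nat \<Rightarrow> real \<Rightarrow> boolfun set \<Rightarrow> nat \<Rightarrow> nat \<Rightarrow> (point set \<Rightarrow> point dtree pmf) \<Rightarrow> bool" where
  "is_tester n \<epsilon> P u q A \<longleftrightarrow>
     (\<forall>U\<in>samples n u. \<forall>t\<in>set_pmf (A U). queries t \<subseteq> U \<and> depth t \<le> q) \<and>
     (\<forall>f\<in>boolfuns n.
        (f \<in> P \<longrightarrow> pmf (outcome n u A f) True \<ge> 2 / 3) \<and>
        (far n \<epsilon> P f \<longrightarrow> pmf (outcome n u A f) False \<ge> 2 / 3))"

text \<open>The active query complexity. It is \<open>\<infinity>\<close> if no number of queries suffices; otherwise the infimum
  is a minimum.\<close>

definition Qa :: "nat \<Rightarrow> real \<Rightarrow> boolfun set \<Rightarrow> nat \<Rightarrow> enat" where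
  "Qa n \<epsilon> P u = (INF q \<in> {q. \<exists>A. is_tester n \<epsilon> P u q A}. enat q)"

end

theory Submission
  imports Defs "HOL-Real_Asymp.Real_Asymp"
begin

text \<open>Yao's principle. Let \<open>m = n div k\<close>. The negative instances are uniformly random functions, which are
  far from \<^const>\<open>Lin\<close> with overwhelming probability. The positive instances are
  \<open>x \<mapsto> x\<^bsub>h 0\<^esub> + \<dots> + x\<^bsub>h (k-1)\<^esub>\<close>, where \<open>h j\<close> is uniform in the \<open>j\<close>-th of \<open>k\<close> disjoint blocks of \<open>m\<close> coordinates.
  The bias of the random bit \<open>\<Sum>x\<in>T. f x\<close> for a positive instance \<open>f\<close> is then the product over the blocks
  of the bias of \<open>y = \<Sum>T\<close> on the block. For random \<open>y\<close> each factor is at most \<open>t = n powr (-1/8) / 4\<close> except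
  with probability \<open>2 * exp (- t\<^sup>2 * m / 4)\<close>. This beats the union bound over the roughly \<open>u ^ q\<close> sets
  \<open>T \<subseteq> U\<close> of size at most \<open>q\<close>. If \<open>q < k * log 2 n / 8\<close>, then \<open>2 ^ q * t ^ k \<le> 1/4\<close>, so by Fourier inversion every
  pattern of answers at \<open>q\<close> or fewer points of \<open>U\<close> is at least \<open>3/4\<close> times as likely under the positive as
  under the negative distribution. This pointwise bound passes to adaptive trees, which therefore reject a
  positive instance with probability about \<open>3/4 * 2/3 > 1/3\<close>.\<close>

text \<open>As simplification rules these turn sums in \<^typ>\<open>bit\<close> into \<open>xor\<close>, out of reach of the group lemmas.\<close>

declare add_bit_eq_xor [simp del] mult_bit_eq_and [simp del]

section \<open>Signs: the real character of the two-element field\<close>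

definition chi :: "bit \<Rightarrow> real" where
  "chi b = (if b = 0 then 1 else -1)"

lemma chi_simps [simp]: "chi 0 = 1" "chi 1 = -1"
  by (auto simp: chi_def)

lemma abs_chi [simp]: "\<bar>chi b\<bar> = 1"
  by (auto simp: chi_def)

lemma bit_add_self: "b + b = (0 :: bit)"
  by (cases b) auto

lemma chi_add: "chi (a + b) = chi a * chi b"
  by (cases a; cases b) (auto simp: chi_def)

lemma chi_sum: "chi (sum f A) = (\<Prod>x\<in>A. chi (f x))"
  by (induction A rule: infinite_finite_induct) (auto simp: chi_add simp del: add_bit_eq_xor)

lemma UNIV_bit: "(UNIV :: bit set) = {0, 1}"
  using bit_not_zero_iff by blast

lemma finite_UNIV_bit [simp]: "finite (UNIV :: bit set)"
  by (simp add: UNIV_bit)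

lemma card_UNIV_bit [simp]: "card (UNIV :: bit set) = 2"
  by (simp add: UNIV_bit)

text \<open>Fourier inversion on the two-element group. Its product over the queried points expands
  the indicator of an answer pattern into characters.\<close>

lemma indicator_bit_eq: "(if a = b then 1 else 0) = (1 + chi a * chi b) / (2 :: real)"
  by (cases a; cases b) (auto simp: chi_def)

section \<open>Exponential tail bounds for random signs\<close>

text \<open>Bounds the moment generating function of a random sign. The exponent
  \<open>x\<^sup>2\<close>, cruder than \<open>x\<^sup>2 / 2\<close>, affects only the constant 4 in
  the tail bounds.\<close>

lemma exp_plus_exp_minus_le:
  fixes x :: real
  assumes "0 \<le> x" "x \<le> 1"
  shows "exp x + exp (- x) \<le> 2 * exp (x\<^sup>2)"
proof -
  have "exp (- x) = 1 / exp x" by (simp add: exp_minus field_simps)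
  also have "\<dots> \<le> 1 / (1 + x)"
    using assms exp_ge_add_one_self[of x] by (intro divide_left_mono) auto
  also have "\<dots> \<le> 1 - x + x\<^sup>2"
  proof -
    have "1 \<le> (1 - x + x\<^sup>2) * (1 + x)"
      using assms by (simp add: algebra_simps power2_eq_square)
    then show ?thesis using assms by (simp add: divide_simps)
  qed
  finally have "exp (- x) \<le> 1 - x + x\<^sup>2" .
  moreover have "exp x \<le> 1 + x + x\<^sup>2" using assms exp_bound by blast
  ultimately show ?thesis using exp_ge_add_one_self[of "x\<^sup>2"] by linarith
qed

text \<open>Chernoff's method: Markov's inequality for the exponential of the signed sum, which
  factors over the coordinates; those outside \<open>B\<close> contribute just a factor 2. The signs
  \<open>\<sigma>\<close> serve both the lower tail and agreement with a fixed function.\<close>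

lemma card_PiE_bit_sum_ge:
  fixes t :: real and \<sigma> :: "'a \<Rightarrow> real"
  assumes "finite A" "B \<subseteq> A" "\<And>i. i \<in> B \<Longrightarrow> \<bar>\<sigma> i\<bar> = 1" "0 \<le> t" "t \<le> 1"
  shows "real (card {y \<in> A \<rightarrow>\<^sub>E UNIV. t * card B \<le> (\<Sum>i\<in>B. \<sigma> i * chi (y i))})
           \<le> 2 ^ card A * exp (- (t\<^sup>2 * card B / 4))"
proof -
  \<comment> \<open>This value minimises \<open>l\<^sup>2 - l * t\<close>, with minimum
    \<open>- t\<^sup>2 / 4\<close>.\<close>
  define l where "l = t / 2"
  have l: "0 \<le> l" "l \<le> 1" using assms by (auto simp: l_def)
  define g where "g i b = (if i \<in> B then exp (l * (\<sigma> i * chi b)) else 1)" for i b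
  let ?Y = "{y \<in> A \<rightarrow>\<^sub>E UNIV. t * card B \<le> (\<Sum>i\<in>B. \<sigma> i * chi (y i))}"
  have finB: "finite B" using assms finite_subset by auto
  have fin: "finite (A \<rightarrow>\<^sub>E (UNIV :: bit set))" using assms by (intro finite_PiE) auto
  have g_sum: "(\<Sum>b\<in>UNIV. g i b) \<le> 2 * (if i \<in> B then exp (l\<^sup>2) else 1)" for i
  proof (cases "i \<in> B")
    case True
    then have "\<sigma> i = 1 \<or> \<sigma> i = -1" using assms(3)[of i] by linarith
    then show ?thesis using True exp_plus_exp_minus_le[OF l] by (auto simp: g_def UNIV_bit)
  qed (auto simp: g_def UNIV_bit)
  have prod_g: "(\<Prod>i\<in>A. g i (y i)) = exp (l * (\<Sum>i\<in>B. \<sigma> i * chi (y i)))" for y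
  proof -
    have "(\<Prod>i\<in>A. g i (y i)) = (\<Prod>i\<in>B. g i (y i))"
      using assms by (intro prod.mono_neutral_right) (auto simp: g_def)
    also have "\<dots> = (\<Prod>i\<in>B. exp (l * (\<sigma> i * chi (y i))))"
      by (intro prod.cong) (auto simp: g_def)
    also have "\<dots> = exp (l * (\<Sum>i\<in>B. \<sigma> i * chi (y i)))"
      using finB by (simp add: exp_sum sum_distrib_left)
    finally show ?thesis .
  qed
  have "real (card ?Y) * exp (l * (t * card B)) = (\<Sum>y\<in>?Y. exp (l * (t * card B)))" by simp
  also have "\<dots> \<le> (\<Sum>y\<in>?Y. \<Prod>i\<in>A. g i (y i))"
    unfolding prod_g by (intro sum_mono) (use l in \<open>auto intro!: mult_left_mono\<close>)
  also have "\<dots> \<le> (\<Sum>y\<in>A \<rightarrow>\<^sub>E UNIV. \<Prod>i\<in>A. g i (y i))"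
    using fin by (intro sum_mono2) (auto simp: g_def intro!: prod_nonneg)
  also have "\<dots> = (\<Prod>i\<in>A. \<Sum>b\<in>UNIV. g i b)"
    using assms by (subst prod_sum_PiE) auto
  also have "\<dots> \<le> (\<Prod>i\<in>A. 2 * (if i \<in> B then exp (l\<^sup>2) else 1))"
    by (intro prod_mono conjI g_sum sum_nonneg) (auto simp: g_def)
  also have "\<dots> = 2 ^ card A * exp (l\<^sup>2 * card B)"
  proof -
    have "(\<Prod>i\<in>A. if i \<in> B then exp (l\<^sup>2) else 1) = (\<Prod>i\<in>B. exp (l\<^sup>2))"
      using assms by (intro prod.mono_neutral_cong_right) auto
    then show ?thesis by (simp add: prod.distrib exp_of_nat_mult [symmetric] mult.commute)
  qed
  finally have "real (card ?Y) \<le> 2 ^ card A * exp (l\<^sup>2 * card B) / exp (l * (t * card B))"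
    by (simp add: pos_le_divide_eq)
  also have "\<dots> = 2 ^ card A * exp (l\<^sup>2 * card B - l * (t * card B))"
    by (simp add: exp_diff)
  also have "l\<^sup>2 * card B - l * (t * card B) = - (t\<^sup>2 * card B / 4)"
    by (simp add: l_def power2_eq_square field_simps)
  finally show ?thesis .
qed

lemma card_PiE_bit_abs_sum_ge:
  fixes t :: real
  assumes "finite A" "B \<subseteq> A" "0 \<le> t" "t \<le> 1"
  shows "real (card {y \<in> A \<rightarrow>\<^sub>E UNIV. t * card B \<le> \<bar>\<Sum>i\<in>B. chi (y i)\<bar>})
           \<le> 2 * 2 ^ card A * exp (- (t\<^sup>2 * card B / 4))"
proof -
  let ?Y = "\<lambda>\<sigma>. {y \<in> A \<rightarrow>\<^sub>E UNIV. t * card B \<le> (\<Sum>i\<in>B. \<sigma> * chi (y i))}"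
  have "{y \<in> A \<rightarrow>\<^sub>E UNIV. t * card B \<le> \<bar>\<Sum>i\<in>B. chi (y i)\<bar>} \<subseteq> ?Y 1 \<union> ?Y (-1)"
    by (auto simp: sum_negf abs_if split: if_splits)
  moreover have "finite (A \<rightarrow>\<^sub>E (UNIV :: bit set))"
    using assms by (intro finite_PiE) auto
  then have "finite (?Y 1 \<union> ?Y (-1))"
    by (rule finite_subset[rotated]) auto
  ultimately have "real (card {y \<in> A \<rightarrow>\<^sub>E UNIV. t * card B \<le> \<bar>\<Sum>i\<in>B. chi (y i)\<bar>})
      \<le> real (card (?Y 1 \<union> ?Y (-1)))"
    by (simp add: card_mono)
  also have "\<dots> \<le> real (card (?Y 1)) + real (card (?Y (-1)))"
    using card_Un_le[of "?Y 1" "?Y (-1)"] by linarith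
  finally show ?thesis
    using card_PiE_bit_sum_ge[of A B "\<lambda>_. 1" t] card_PiE_bit_sum_ge[of A B "\<lambda>_. -1" t] assms
    by simp
qed

section \<open>Sizes of the finite spaces\<close>

lemma finite_cube [simp]: "finite (cube n)"
  by (auto simp: cube_def intro!: finite_PiE)

lemma card_cube [simp]: "card (cube n) = 2 ^ n"
  by (simp add: cube_def card_PiE)

lemma finite_boolfuns [simp]: "finite (boolfuns n)"
  by (auto simp: boolfuns_def intro!: finite_PiE)

lemma card_boolfuns: "card (boolfuns n) = 2 ^ 2 ^ n"
  by (simp add: boolfuns_def card_PiE)

lemma boolfuns_nonempty [simp]: "boolfuns n \<noteq> {}"
  using card_boolfuns[of n] by auto

lemma finite_samples [simp]: "finite (samples n u)"
  by (simp add: samples_def)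

lemma card_samples: "card (samples n u) = 2 ^ n choose u"
  by (simp add: samples_def n_subsets)

lemma samples_nonempty:
  assumes "u \<le> 2 ^ n" shows "samples n u \<noteq> {}"
proof -
  have "card (samples n u) > 0" using assms by (simp add: card_samples)
  then show ?thesis by auto
qed

text \<open>A set of size at most \<open>q\<close> is the set of entries of a list of length
  \<open>q\<close> padded with \<open>None\<close>. For \<open>card V = u - 1\<close> the bound is
  \<open>u ^ q\<close>.\<close>

lemma card_small_subsets:
  assumes "finite V"
  shows "card {T. T \<subseteq> V \<and> card T \<le> q} \<le> (card V + 1) ^ q"
proof -
  let ?L = "{xs. set xs \<subseteq> insert None (Some ` V) \<and> length xs = q}"
  have "{T. T \<subseteq> V \<and> card T \<le> q} \<subseteq> (\<lambda>xs. {x. Some x \<in> set xs}) ` ?L"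
  proof
    fix T assume T: "T \<in> {T. T \<subseteq> V \<and> card T \<le> q}"
    then have "finite T" using assms finite_subset by auto
    then obtain ys where ys: "set ys = T" "distinct ys" using finite_distinct_list by blast
    then have len: "length ys \<le> q" using T distinct_card by fastforce
    define xs where "xs = map Some ys @ replicate (q - length ys) None"
    have "xs \<in> ?L" using len ys T by (auto simp: xs_def)
    moreover have "T = {x. Some x \<in> set xs}" using ys by (auto simp: xs_def)
    ultimately show "T \<in> (\<lambda>xs. {x. Some x \<in> set xs}) ` ?L" by blast
  qed
  moreover have "finite ?L" using assms by (intro finite_lists_length_eq) auto
  ultimately have "card {T. T \<subseteq> V \<and> card T \<le> q} \<le> card ?L"
    by (meson card_image_le card_mono finite_imageI le_trans)
  also have "\<dots> = (card V + 1) ^ q"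
    using assms by (subst card_lists_length_eq) (auto simp: card_insert_if card_image)
  finally show ?thesis .
qed

section \<open>Samples containing a small set with a bad sum\<close>

text \<open>The vector sum in the cube, kept extensional so as to be a point. For a linear
  \<open>f\<close> the answers on \<open>T\<close> add up to \<open>f (psum n T)\<close>, so this
  point governs their bias.\<close>

definition psum :: "nat \<Rightarrow> point set \<Rightarrow> point" where
  "psum n T = (\<lambda>i\<in>{0..<n}. \<Sum>x\<in>T. x i)"

text \<open>\<open>T\<close> has to be nonempty: the empty sum is the zero point, which is maximally
  biased but only yields the main Fourier term.\<close>

definition hits :: "nat \<Rightarrow> nat \<Rightarrow> point set \<Rightarrow> point set \<Rightarrow> bool" where
  "hits n q Y U \<longleftrightarrow> (\<exists>T\<subseteq>U. T \<noteq> {} \<and> card T \<le> q \<and> psum n T \<in> Y)"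

text \<open>If the sum of \<open>T \<subseteq> U\<close> is \<open>y \<in> Y\<close>, then any \<open>x \<in> T\<close> is determined by \<open>y\<close> and the other elements
  of \<open>T\<close>, so \<open>U\<close> is determined by \<open>U - {x}\<close>, \<open>T - {x}\<close> and \<open>y\<close>.\<close>

lemma card_hits_le:
  assumes "finite Y" "u > 0"
  shows "card {U \<in> samples n u. hits n q Y U} \<le> (2 ^ n choose (u - 1)) * (u ^ q * card Y)"
proof -
  let ?D = "SIGMA V:samples n (u - 1). {T. T \<subseteq> V \<and> card T \<le> q} \<times> Y"
  let ?F = "\<lambda>(V, T, y). insert (\<lambda>i\<in>{0..<n}. y i + (\<Sum>x\<in>T. x i)) V"
  have finV: "finite V" if "V \<in> samples n v" for V v
    using that finite_cube[of n] finite_subset[of V "cube n"] by (auto simp: samples_def)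
  have "{U \<in> samples n u. hits n q Y U} \<subseteq> ?F ` ?D"
  proof
    fix U assume "U \<in> {U \<in> samples n u. hits n q Y U}"
    then obtain T where U: "U \<in> samples n u" and T: "T \<subseteq> U" "T \<noteq> {}" "card T \<le> q" "psum n T \<in> Y"
      by (auto simp: hits_def)
    then obtain x where x: "x \<in> T" by auto
    have fin: "finite U" "finite T" using finV[OF U] T finite_subset by auto
    have "x \<in> cube n" using x T U by (auto simp: samples_def)
    then have "(\<lambda>i\<in>{0..<n}. psum n T i + (\<Sum>z\<in>T - {x}. z i)) = x"
    proof -
      have "(\<Sum>z\<in>T. z i) + (\<Sum>z\<in>T - {x}. z i) = x i" for i
      proof -
        have "(\<Sum>z\<in>T. z i) = x i + (\<Sum>z\<in>T - {x}. z i)"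
          using fin x by (simp add: sum.remove)
        then show ?thesis by (simp add: add.assoc bit_add_self)
      qed
      then show ?thesis
        using \<open>x \<in> cube n\<close>
        by (auto simp: psum_def cube_def PiE_def extensional_def fun_eq_iff)
    qed
    then have "?F (U - {x}, T - {x}, psum n T) = U" using x T by auto
    moreover have "(U - {x}, T - {x}, psum n T) \<in> ?D"
      using U T x fin by (auto simp: samples_def)
    ultimately show "U \<in> ?F ` ?D" by (metis (no_types, lifting) imageI)
  qed
  moreover have finD: "finite ?D"
    using assms finV by (auto intro!: finite_SigmaI)
  ultimately have "card {U \<in> samples n u. hits n q Y U} \<le> card ?D"
    by (meson card_image_le card_mono finite_imageI le_trans)
  also have "\<dots> = (\<Sum>V\<in>samples n (u - 1). card {T. T \<subseteq> V \<and> card T \<le> q} * card Y)"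
    using finV assms by (subst card_SigmaI) (auto simp: card_cartesian_product)
  also have "\<dots> \<le> (\<Sum>V\<in>samples n (u - 1). u ^ q * card Y)"
  proof (intro sum_mono mult_right_mono)
    fix V assume V: "V \<in> samples n (u - 1)"
    then have "card V + 1 = u" using assms by (auto simp: samples_def)
    then show "card {T. T \<subseteq> V \<and> card T \<le> q} \<le> u ^ q"
      using card_small_subsets[of V q] finV[OF V] by simp
  qed auto
  also have "\<dots> = (2 ^ n choose (u - 1)) * (u ^ q * card Y)"
    by (simp add: card_samples)
  finally show ?thesis .
qed

text \<open>Divide \<open>card_hits_le\<close> by the number of samples. The ratio of the two
  binomials supplies the factor 2, the denominator \<open>2 ^ n\<close> and the extra
  \<open>u\<close> in \<open>u ^ (q + 1)\<close>.\<close>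

lemma prob_hits_le:
  assumes "Y \<subseteq> cube n" "0 < u" "2 * u \<le> 2 ^ n"
  shows "measure (pmf_of_set (samples n u)) {U. hits n q Y U} \<le> 2 * real u ^ (q + 1) * card Y / 2 ^ n"
proof -
  have u: "u \<le> 2 ^ n" using assms by simp
  define N :: nat where "N = 2 ^ n"
  have finY: "finite Y" using assms finite_cube finite_subset by blast
  have "measure (pmf_of_set (samples n u)) {U. hits n q Y U} =
      real (card {U \<in> samples n u. hits n q Y U}) / real (N choose u)"
    using samples_nonempty[OF u] by (simp add: measure_pmf_of_set card_samples Int_def N_def)
  also have "\<dots> \<le> real ((N choose (u - 1)) * (u ^ q * card Y)) / real (N choose u)"
    using card_hits_le[OF finY assms(2), of n q] by (intro divide_right_mono) (auto simp: N_def simp del: of_nat_mult)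
  also have "\<dots> = (real u ^ q * card Y) * (real (N choose (u - 1)) / real (N choose u))"
    by simp
  also have "\<dots> \<le> (real u ^ q * card Y) * (2 * real u / N)"
  proof (rule mult_left_mono)
    obtain v where v: "u = Suc v" using assms(2) gr0_conv_Suc by auto
    \<comment> \<open>The ratio of the binomials is thus \<open>u / (N - u + 1)\<close>, at most
      \<open>2 * u / N\<close> because \<open>2 * u \<le> N\<close>.\<close>
    have "Suc v * (N choose Suc v) = (N - v) * (N choose v)"
      by (metis binomial_absorption binomial_absorb_comp)
    then have eq: "real (Suc v) * real (N choose Suc v) = (real N - real v) * real (N choose v)"
      using u v by (metis (no_types, lifting) N_def Suc_leD of_nat_diff of_nat_mult)
    have "real N / 2 * real (N choose v) \<le> (real N - real v) * real (N choose v)"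
    proof (rule mult_right_mono)
      have "2 * v \<le> N" using assms v by (simp add: N_def)
      then have "2 * real v \<le> real N" by linarith
      then show "real N / 2 \<le> real N - real v" by linarith
    qed auto
    then have "real N * real (N choose v) \<le> 2 * real u * real (N choose u)"
      using eq v by (simp add: algebra_simps)
    moreover have "N choose u > 0" "N > 0" using u by (auto simp: N_def)
    ultimately show "real (N choose (u - 1)) / real (N choose u) \<le> 2 * real u / N"
      using v by (simp add: divide_simps mult_ac)
  qed auto
  also have "\<dots> = 2 * real u ^ (q + 1) * card Y / 2 ^ n"
    by (simp add: N_def)
  finally show ?thesis .
qed

section \<open>From answer patterns to adaptive trees\<close>

text \<open>The event is a disjoint union of cylinders, one for each reachable leaf with verdict
  \<open>b\<close>. Each fixes at most \<open>q\<close> values, so the bounds on cylinders add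
  up.\<close>

lemma dtree_prob_mono:
  fixes p p' :: "('a \<Rightarrow> bit) pmf"
  assumes le: "\<And>S a. S \<subseteq> U \<Longrightarrow> finite S \<Longrightarrow> card S \<le> q \<Longrightarrow>
      c * measure p' {f. \<forall>x\<in>S. f x = a x} \<le> measure p {f. \<forall>x\<in>S. f x = a x}"
  assumes "queries t \<subseteq> U" "depth t \<le> q"
  shows "c * measure p' {f. run t f = b} \<le> measure p {f. run t f = b}"
proof -
  \<comment> \<open>\<open>S\<close> and \<open>a\<close> record the points queried so far and their
    answers; \<open>card S + depth t \<le> q\<close> leaves room for the remaining queries.\<close>
  have "c * measure p' {f. (\<forall>x\<in>S. f x = a x) \<and> run t f = b}
      \<le> measure p {f. (\<forall>x\<in>S. f x = a x) \<and> run t f = b}"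
    if "queries t \<subseteq> U" "S \<subseteq> U" "finite S" "card S + depth t \<le> q" for S a
    using that
  proof (induction t arbitrary: S a)
    case (Verdict v)
    then show ?case using le[of S a] by (cases "v = b") auto
  next
    case (Query x t0 t1)
    let ?E = "\<lambda>S a t. {f. (\<forall>x\<in>S. f x = a x) \<and> run t f = b}"
    have sub: "queries t0 \<subseteq> U" "queries t1 \<subseteq> U" "x \<in> U" using Query.prems by auto
    show ?case
    proof (cases "x \<in> S")
      \<comment> \<open>A repeated query brings no information: \<open>a x\<close> decides the
        branch and \<open>S\<close> does not grow.\<close>
      case True
      then have "?E S a (Query x t0 t1) = ?E S a (if a x = 0 then t0 else t1)" by auto
      then show ?thesis
        using Query.IH(1)[of S a] Query.IH(2)[of S a] Query.prems sub by (auto split: if_splits)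
    next
      case False
      let ?S = "insert x S"
      have E: "?E S a (Query x t0 t1) = ?E ?S (a(x := 0)) t0 \<union> ?E ?S (a(x := 1)) t1"
        using False by (auto simp: fun_upd_def)
      have split: "measure r (?E S a (Query x t0 t1)) =
          measure r (?E ?S (a(x := 0)) t0) + measure r (?E ?S (a(x := 1)) t1)" for r :: "('a \<Rightarrow> bit) pmf"
        unfolding E by (intro measure_pmf.finite_measure_Union) auto
      have "c * measure p' (?E ?S (a(x := 0)) t0) \<le> measure p (?E ?S (a(x := 0)) t0)"
        using Query.prems sub False by (intro Query.IH) auto
      moreover have "c * measure p' (?E ?S (a(x := 1)) t1) \<le> measure p (?E ?S (a(x := 1)) t1)"
        using Query.prems sub False by (intro Query.IH) auto
      ultimately show ?thesis unfolding split by (simp add: algebra_simps)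
    qed
  qed
  from this[of "{}"] assms show ?thesis by simp
qed

lemma measure_boolfuns_cylinder:
  assumes "S \<subseteq> cube n"
  shows "measure (pmf_of_set (boolfuns n)) {f. \<forall>x\<in>S. f x = a x} = 1 / 2 ^ card S"
proof -
  have fin: "finite S" using assms by (rule finite_subset) simp
  let ?B = "\<lambda>x. if x \<in> S then {a x} else UNIV"
  have "boolfuns n \<inter> {f. \<forall>x\<in>S. f x = a x} = PiE (cube n) ?B"
    using assms by (fastforce simp: boolfuns_def PiE_iff extensional_def split: if_splits)
  then have "card (boolfuns n \<inter> {f. \<forall>x\<in>S. f x = a x}) = (\<Prod>x\<in>cube n. card (?B x))"
    by (simp add: card_PiE)
  also have "\<dots> = (\<Prod>x\<in>cube n - S. 2)"
    by (intro prod.mono_neutral_cong_right) auto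
  also have "\<dots> = 2 ^ (2 ^ n - card S)"
    using assms fin by (simp add: card_Diff_subset)
  finally have "card (boolfuns n \<inter> {f. \<forall>x\<in>S. f x = a x}) = 2 ^ (2 ^ n - card S)" .
  moreover have "card S \<le> 2 ^ n" using assms card_mono[of "cube n" S] by simp
  moreover have "(2 :: real) ^ (2 ^ n - card S) = 2 ^ 2 ^ n / 2 ^ card S" if "card S \<le> 2 ^ n"
    using that by (simp add: power_diff)
  ultimately show ?thesis
    by (simp add: measure_pmf_of_set card_boolfuns)
qed

section \<open>Positive instances and their answer patterns\<close>

definition block :: "nat \<Rightarrow> nat \<Rightarrow> nat set" where
  "block m j = {j * m..<(j + 1) * m}"

text \<open>One independent coordinate per block, instead of a random \<open>k\<close>-subset, makes
  averages of characters factor over the blocks.\<close>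

definition transversals :: "nat \<Rightarrow> nat \<Rightarrow> (nat \<Rightarrow> nat) set" where
  "transversals m k = (\<Pi>\<^sub>E j\<in>{..<k}. block m j)"

definition lin :: "nat \<Rightarrow> nat \<Rightarrow> (nat \<Rightarrow> nat) \<Rightarrow> boolfun" where
  "lin n k h = (\<lambda>x\<in>cube n. \<Sum>j<k. x (h j))"

definition yes :: "nat \<Rightarrow> nat \<Rightarrow> nat \<Rightarrow> boolfun pmf" where
  "yes n m k = map_pmf (lin n k) (pmf_of_set (transversals m k))"

lemma card_block [simp]: "card (block m j) = m"
  by (simp add: block_def)

lemma finite_block [simp]: "finite (block m j)"
  by (simp add: block_def)

lemma block_subset:
  assumes "j < k" "k * m \<le> n"
  shows "block m j \<subseteq> {0..<n}"
proof -
  have "(j + 1) * m \<le> k * m" using assms by (intro mult_right_mono) auto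
  then show ?thesis using assms by (auto simp: block_def)
qed

lemma block_div: "i \<in> block m j \<Longrightarrow> i div m = j"
  by (simp add: block_def div_nat_eqI mult.commute)

lemma finite_transversals [simp]: "finite (transversals m k)"
  by (auto simp: transversals_def intro!: finite_PiE)

lemma card_transversals [simp]: "card (transversals m k) = m ^ k"
  by (simp add: transversals_def card_PiE)

lemma transversals_nonempty: "m > 0 \<Longrightarrow> transversals m k \<noteq> {}"
  using card_transversals[of m k] by fastforce

lemma lin_in_Lin:
  assumes h: "h \<in> transversals m k" and "k * m \<le> n"
  shows "lin n k h \<in> Lin n k"
proof -
  have hj: "h j \<in> block m j" if "j < k" for j
    using h that by (auto simp: transversals_def PiE_iff)
  \<comment> \<open>Division by \<open>m\<close> recovers the block, so distinct indices give
    distinct coordinates.\<close>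
  have inj: "inj_on h {..<k}"
    by (rule inj_onI) (metis block_div hj lessThan_iff)
  have "h ` {..<k} \<subseteq> {0..<n}" using hj block_subset[OF _ assms(2)] by blast
  moreover have "lin n k h = (\<lambda>x\<in>cube n. \<Sum>i\<in>h ` {..<k}. x i)"
    using inj by (simp add: lin_def sum.reindex)
  ultimately show ?thesis using inj unfolding Lin_def by (force simp: card_image)
qed

text \<open>Fourier expansion of the indicator of the cylinder: the term of \<open>T = {}\<close> is the main term
  \<open>2 ^ (- card S)\<close>, and every other term factors over the blocks.\<close>

lemma measure_yes_cylinder:
  fixes t \<delta> :: real
  assumes S: "S \<subseteq> cube n" and km: "k * m \<le> n" "m > 0"
    and small: "\<And>T j. T \<subseteq> S \<Longrightarrow> T \<noteq> {} \<Longrightarrow> j < k \<Longrightarrow> \<bar>\<Sum>i\<in>block m j. chi (psum n T i)\<bar> \<le> t * m"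
    and \<delta>: "2 ^ card S * t ^ k \<le> \<delta>" and t: "0 \<le> t"
  shows "(1 - \<delta>) / 2 ^ card S \<le> measure (yes n m k) {f. \<forall>x\<in>S. f x = a x}"
proof -
  have fin: "finite S" using S by (rule finite_subset) simp
  let ?H = "transversals m k"
  \<comment> \<open>The Fourier coefficient of \<open>yes\<close> at \<open>T\<close>, scaled by
    \<open>m ^ k\<close>.\<close>
  define \<phi> where "\<phi> T = (\<Sum>h\<in>?H. \<Prod>x\<in>T. chi (lin n k h x))" for T
  \<comment> \<open>Linearity moves the sum over \<open>T\<close> inside; summing the resulting
    product over all transversals gives a product of block sums.\<close>
  have \<phi>_eq: "\<phi> T = (\<Prod>j<k. \<Sum>i\<in>block m j. chi (psum n T i))" if T: "T \<subseteq> S" for T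
  proof -
    have "(\<Prod>x\<in>T. chi (lin n k h x)) = (\<Prod>j<k. chi (psum n T (h j)))" if h: "h \<in> ?H" for h
    proof -
      have hj: "h j < n" if "j < k" for j
        using h that block_subset[OF that km(1)] by (auto simp: transversals_def PiE_iff)
      have "(\<Prod>x\<in>T. chi (lin n k h x)) = (\<Prod>x\<in>T. \<Prod>j<k. chi (x (h j)))"
        using T S by (intro prod.cong) (auto simp: lin_def chi_sum)
      also have "\<dots> = (\<Prod>j<k. \<Prod>x\<in>T. chi (x (h j)))" by (rule prod.swap)
      also have "\<dots> = (\<Prod>j<k. chi (psum n T (h j)))"
        using hj by (intro prod.cong) (auto simp: psum_def chi_sum)
      finally show ?thesis .
    qed
    then show ?thesis by (simp add: \<phi>_def prod_sum_PiE transversals_def)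
  qed
  have \<phi>_small: "\<bar>\<phi> T\<bar> \<le> t ^ k * real m ^ k" if "T \<subseteq> S" "T \<noteq> {}" for T
  proof -
    have "\<bar>\<phi> T\<bar> = (\<Prod>j<k. \<bar>\<Sum>i\<in>block m j. chi (psum n T i)\<bar>)"
      using that by (simp add: \<phi>_eq abs_prod)
    also have "\<dots> \<le> (\<Prod>j<k. t * m)"
      using that by (intro prod_mono conjI small) auto
    finally show ?thesis by (simp add: power_mult_distrib)
  qed
  let ?C = "{h \<in> ?H. \<forall>x\<in>S. lin n k h x = a x}"
  have "real (card ?C) = (\<Sum>h\<in>?H. if \<forall>x\<in>S. lin n k h x = a x then 1 else 0)"
    by (simp add: sum.If_cases Int_def)
  also have "\<dots> = (\<Sum>h\<in>?H. \<Prod>x\<in>S. (1 + chi (a x) * chi (lin n k h x)) / 2)"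
  proof (intro sum.cong refl)
    fix h
    have "(\<Prod>x\<in>S. (1 + chi (a x) * chi (lin n k h x)) / 2) = (\<Prod>x\<in>S. if a x = lin n k h x then 1 else 0)"
      by (simp add: indicator_bit_eq)
    also have "\<dots> = (if \<forall>x\<in>S. lin n k h x = a x then 1 else 0)"
    proof (cases "\<forall>x\<in>S. lin n k h x = a x")
      case False
      then obtain x where "x \<in> S" "a x \<noteq> lin n k h x" by metis
      then have "\<exists>x\<in>S. (if a x = lin n k h x then 1 else 0) = (0 :: real)"
        by (intro bexI[of _ x]) simp_all
      then have "(\<Prod>x\<in>S. if a x = lin n k h x then 1 else 0 :: real) = 0"
        using fin by (simp only: prod_zero)
      then show ?thesis using False by (simp only: if_False)
    qed simp
    finally show "(if \<forall>x\<in>S. lin n k h x = a x then 1 else 0) =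
        (\<Prod>x\<in>S. (1 + chi (a x) * chi (lin n k h x)) / 2)" by simp
  qed
  also have "\<dots> = (\<Sum>h\<in>?H. (\<Sum>T\<in>Pow S. (\<Prod>x\<in>T. chi (a x)) * (\<Prod>x\<in>T. chi (lin n k h x)))) / 2 ^ card S"
  proof -
    \<comment> \<open>Multiplying out: \<open>T\<close> is the set of factors in which the
      character, not the 1, is chosen.\<close>
    have "(\<Prod>x\<in>S. (1 + chi (a x) * chi (lin n k h x)) / 2) =
        (\<Sum>T\<in>Pow S. (\<Prod>x\<in>T. chi (a x)) * (\<Prod>x\<in>T. chi (lin n k h x))) / 2 ^ card S" for h
      using prod_add[OF fin, of "\<lambda>x. chi (a x) * chi (lin n k h x)" "\<lambda>_. 1"]
      by (simp add: prod_dividef prod.distrib add.commute)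
    then show ?thesis by (simp add: sum_divide_distrib)
  qed
  also have "\<dots> = (\<Sum>T\<in>Pow S. (\<Prod>x\<in>T. chi (a x)) * \<phi> T) / 2 ^ card S"
    unfolding \<phi>_def sum_distrib_left by (subst sum.swap) simp
  finally have card_C: "real (card ?C) = (\<Sum>T\<in>Pow S. (\<Prod>x\<in>T. chi (a x)) * \<phi> T) / 2 ^ card S" .
  \<comment> \<open>Fewer than \<open>2 ^ card S\<close> terms remain, each at most
    \<open>(t * m) ^ k\<close> in absolute value.\<close>
  have "\<bar>\<Sum>T\<in>Pow S - {{}}. (\<Prod>x\<in>T. chi (a x)) * \<phi> T\<bar> \<le> (\<Sum>T\<in>Pow S - {{}}. t ^ k * real m ^ k)"
    by (intro sum_abs[THEN order_trans] sum_mono) (simp add: abs_mult abs_prod \<phi>_small)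
  also have "\<dots> \<le> (\<Sum>T\<in>Pow S. t ^ k * real m ^ k)"
    using fin t by (intro sum_mono2) auto
  also have "\<dots> = (2 ^ card S * t ^ k) * real m ^ k"
    using fin by (simp add: card_Pow)
  also have "\<dots> \<le> \<delta> * real m ^ k"
    using \<delta> by (intro mult_right_mono) auto
  finally have rest: "- (\<delta> * real m ^ k) \<le> (\<Sum>T\<in>Pow S - {{}}. (\<Prod>x\<in>T. chi (a x)) * \<phi> T)"
    by linarith
  \<comment> \<open>The main term \<open>\<phi> {}\<close> is \<open>m ^ k\<close>, the number of
    transversals.\<close>
  have "(\<Sum>T\<in>Pow S. (\<Prod>x\<in>T. chi (a x)) * \<phi> T) =
      \<phi> {} + (\<Sum>T\<in>Pow S - {{}}. (\<Prod>x\<in>T. chi (a x)) * \<phi> T)"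
    using fin by (subst sum.remove[of _ "{}"]) auto
  then have "(1 - \<delta>) * real m ^ k / 2 ^ card S \<le> card ?C"
    unfolding card_C using rest
    by (intro divide_right_mono) (auto simp: \<phi>_def algebra_simps)
  moreover have "measure (yes n m k) {f. \<forall>x\<in>S. f x = a x} = real (card ?C) / real m ^ k"
    using transversals_nonempty[OF km(2)]
    by (simp add: yes_def measure_pmf_of_set Int_def vimage_def)
  moreover have "(1 - \<delta>) / 2 ^ card S = (1 - \<delta>) * real m ^ k / 2 ^ card S / real m ^ k"
    using km(2) by simp
  ultimately show ?thesis
    by (simp only: divide_right_mono zero_le_power of_nat_0_le_iff)
qed

lemma psum_in_cube: "psum n T \<in> cube n"
  by (simp add: psum_def cube_def)

text \<open>In a sample that is not hit, every nonempty set of at most \<open>q\<close> points has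
  small bias on all blocks. So \<open>measure_yes_cylinder\<close> applies with
  \<open>\<delta> = 1 / 4\<close>, and \<open>dtree_prob_mono\<close> lifts the comparison to
  trees.\<close>

lemma yes_ge_uniform:
  fixes t :: real
  assumes "U \<subseteq> cube n" "k * m \<le> n" "m > 0" "0 \<le> t" "2 ^ q * t ^ k \<le> 1 / 4"
    and "\<not> hits n q {y \<in> cube n. \<exists>j<k. t * m \<le> \<bar>\<Sum>i\<in>block m j. chi (y i)\<bar>} U"
    and "queries r \<subseteq> U" "depth r \<le> q"
  shows "3 / 4 * measure (pmf_of_set (boolfuns n)) {f. run r f = b} \<le> measure (yes n m k) {f. run r f = b}"
proof (rule dtree_prob_mono[OF _ assms(7,8)])
  fix S a assume S: "S \<subseteq> U" "finite S" "card S \<le> q"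
  have "(1 - 1 / 4) / 2 ^ card S \<le> measure (yes n m k) {f. \<forall>x\<in>S. f x = a x}"
  proof (rule measure_yes_cylinder[where t = t])
    fix T j assume T: "T \<subseteq> S" "T \<noteq> {}" "j < k"
    then have "card T \<le> q" using S card_mono le_trans by blast
    then have "psum n T \<notin> {y \<in> cube n. \<exists>j<k. t * m \<le> \<bar>\<Sum>i\<in>block m j. chi (y i)\<bar>}"
      using assms(6) T S unfolding hits_def by blast
    then show "\<bar>\<Sum>i\<in>block m j. chi (psum n T i)\<bar> \<le> t * m"
      using T psum_in_cube by (auto simp: not_le intro: less_imp_le)
  next
    have "2 ^ card S * t ^ k \<le> 2 ^ q * t ^ k"
      using S assms by (intro mult_right_mono power_increasing) auto
    then show "2 ^ card S * t ^ k \<le> 1 / 4" using assms by linarith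
  qed (use S assms in auto)
  then show "3 / 4 * measure (pmf_of_set (boolfuns n)) {f. \<forall>x\<in>S. f x = a x}
      \<le> measure (yes n m k) {f. \<forall>x\<in>S. f x = a x}"
    using S assms by (subst measure_boolfuns_cylinder) auto
qed

section \<open>Random functions are far from the linear ones\<close>

lemma card_Lin_le: "finite (Lin n k)" "card (Lin n k) \<le> 2 ^ n"
proof -
  have sub: "Lin n k \<subseteq> (\<lambda>I. \<lambda>x\<in>cube n. \<Sum>i\<in>I. x i) ` Pow {0..<n}"
    by (auto simp: Lin_def)
  then show "finite (Lin n k)" by (rule finite_subset) simp
  have "card (Lin n k) \<le> card ((\<lambda>I. \<lambda>x\<in>cube n. \<Sum>i\<in>I. x i) ` Pow {0..<n})"
    using sub by (intro card_mono) auto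
  also have "\<dots> \<le> card (Pow {0..<n})" by (intro card_image_le) auto
  finally show "card (Lin n k) \<le> 2 ^ n" by (simp add: card_Pow)
qed

lemma Lin_subset_boolfuns: "Lin n k \<subseteq> boolfuns n"
  by (auto simp: Lin_def boolfuns_def)

text \<open>The correlation of \<open>f\<close> and \<open>g\<close> is \<open>2 ^ n\<close> minus
  twice their distance, so closeness forces it above the fraction
  \<open>1 - 2 / 1000 = 499 / 500\<close>. The tail bound applies with signs
  \<open>chi (g x)\<close>.\<close>

lemma card_close_le:
  assumes "\<epsilon> \<le> 1 / 1000"
  shows "real (card {f \<in> boolfuns n. real (card {x \<in> cube n. f x \<noteq> g x}) < \<epsilon> * 2 ^ n})
    \<le> 2 ^ 2 ^ n * exp (- (2 ^ n / 5))"
proof -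
  let ?F = "{f \<in> cube n \<rightarrow>\<^sub>E UNIV. 499 / 500 * card (cube n) \<le> (\<Sum>x\<in>cube n. chi (g x) * chi (f x))}"
  have sub: "{f \<in> boolfuns n. real (card {x \<in> cube n. f x \<noteq> g x}) < \<epsilon> * 2 ^ n} \<subseteq> ?F"
  proof
    fix f assume f: "f \<in> {f \<in> boolfuns n. real (card {x \<in> cube n. f x \<noteq> g x}) < \<epsilon> * 2 ^ n}"
    have "chi (g x) * chi (f x) = 1 - 2 * (if f x \<noteq> g x then 1 else 0)" for x
      by (cases "f x"; cases "g x") auto
    then have "(\<Sum>x\<in>cube n. chi (g x) * chi (f x)) =
        2 ^ n - 2 * real (card {x \<in> cube n. f x \<noteq> g x})"
      by (simp add: sum_subtractf sum_distrib_left [symmetric] sum.If_cases Int_def)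
    moreover have "real (card {x \<in> cube n. f x \<noteq> g x}) < \<epsilon> * 2 ^ n" using f by simp
    moreover have "\<epsilon> * 2 ^ n \<le> 1 / 1000 * 2 ^ n" using assms by (intro mult_right_mono) auto
    ultimately have "499 / 500 * 2 ^ n \<le> (\<Sum>x\<in>cube n. chi (g x) * chi (f x))" by linarith
    then show "f \<in> ?F" using f by (simp add: boolfuns_def)
  qed
  have "finite ?F" using finite_boolfuns[of n] unfolding boolfuns_def by simp
  then have "real (card {f \<in> boolfuns n. real (card {x \<in> cube n. f x \<noteq> g x}) < \<epsilon> * 2 ^ n}) \<le> card ?F"
    using sub by (simp add: card_mono)
  also have "\<dots> \<le> 2 ^ card (cube n) * exp (- ((499 / 500)\<^sup>2 * card (cube n) / 4))"
    by (rule card_PiE_bit_sum_ge) auto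
  \<comment> \<open>\<open>(499 / 500)\<^sup>2 / 4\<close> exceeds \<open>1 / 5\<close>.\<close>
  also have "\<dots> \<le> 2 ^ 2 ^ n * exp (- (2 ^ n / 5))"
    by (auto simp: power2_eq_square)
  finally show ?thesis .
qed

text \<open>Union bound over the at most \<open>2 ^ n\<close> members of
  \<open>Lin n k\<close>.\<close>

lemma prob_far_Lin_ge:
  assumes "\<epsilon> \<le> 1 / 1000"
  shows "1 - 2 ^ n * exp (- (2 ^ n / 5)) \<le> measure (pmf_of_set (boolfuns n)) {f. far n \<epsilon> (Lin n k) f}"
proof -
  let ?C = "\<lambda>g. {f \<in> boolfuns n. real (card {x \<in> cube n. f x \<noteq> g x}) < \<epsilon> * 2 ^ n}"
  have "{f \<in> boolfuns n. \<not> far n \<epsilon> (Lin n k) f} = (\<Union>g\<in>Lin n k. ?C g)"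
    by (auto simp: far_def not_le)
  then have "real (card {f \<in> boolfuns n. \<not> far n \<epsilon> (Lin n k) f}) \<le> (\<Sum>g\<in>Lin n k. card (?C g))"
    using card_UN_le[OF card_Lin_le(1), of ?C] by (simp del: of_nat_sum)
  also have "\<dots> \<le> (\<Sum>g\<in>Lin n k. 2 ^ 2 ^ n * exp (- (2 ^ n / 5)))"
    unfolding of_nat_sum by (intro sum_mono card_close_le assms)
  also have "\<dots> \<le> 2 ^ n * (2 ^ 2 ^ n * exp (- (2 ^ n / 5)))"
    using card_Lin_le(2)[of n k] by (auto simp flip: of_nat_power[of 2, simplified])
  finally have "measure (pmf_of_set (boolfuns n)) {f. \<not> far n \<epsilon> (Lin n k) f} \<le> 2 ^ n * exp (- (2 ^ n / 5))"
    by (simp add: measure_pmf_of_set card_boolfuns Int_def field_simps)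
  then show ?thesis
    using measure_pmf.prob_neg[of "pmf_of_set (boolfuns n)" "far n \<epsilon> (Lin n k)"] by simp
qed

section \<open>Yao's argument\<close>

text \<open>Exchanging the order of the random choices lets \<open>f\<close> be drawn last, against
  a fixed sample and a fixed tree.\<close>

lemma pmf_bind_outcome:
  "pmf (bind_pmf p (outcome n u A)) b =
    measure_pmf.expectation (pmf_of_set (samples n u))
      (\<lambda>U. measure_pmf.expectation (A U) (\<lambda>t. measure p {f. run t f = b}))"
proof -
  have "bind_pmf p (outcome n u A) =
      bind_pmf (pmf_of_set (samples n u)) (\<lambda>U. bind_pmf p (\<lambda>f. bind_pmf (A U) (\<lambda>t. return_pmf (run t f))))"
    unfolding outcome_def map_pmf_def by (rule bind_commute_pmf)
  also have "\<dots> = bind_pmf (pmf_of_set (samples n u)) (\<lambda>U. bind_pmf (A U) (\<lambda>t. map_pmf (run t) p))"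
    unfolding map_pmf_def by (intro bind_pmf_cong refl bind_commute_pmf)
  finally show ?thesis
    by (simp add: pmf_bind pmf_map vimage_def)
qed

lemma integrable_pmf_bounded:
  assumes "\<And>x. \<bar>f x :: real\<bar> \<le> B"
  shows "integrable (measure_pmf p) f"
  using assms by (intro measure_pmf.integrable_const_bound[where B = B]) auto

lemma no_tester:
  fixes t :: real
  assumes tester: "is_tester n \<epsilon> (Lin n k) u q A" and \<epsilon>: "\<epsilon> \<le> 1 / 1000"
    and m: "k * m \<le> n" "m > 0" and u: "u > 0" "2 * u \<le> 2 ^ n"
    and t: "0 \<le> t" "t \<le> 1" "2 ^ q * t ^ k \<le> 1 / 4"
    and bad: "4 * real k * real u ^ (q + 1) * exp (- (t\<^sup>2 * m / 4)) \<le> 1 / 20"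
    and far: "2 ^ n * exp (- (2 ^ n / 5)) \<le> (1 / 20 :: real)"
  shows False
proof -
  define Y where "Y = {y \<in> cube n. \<exists>j<k. t * m \<le> \<bar>\<Sum>i\<in>block m j. chi (y i)\<bar>}"
  define no where "no = pmf_of_set (boolfuns n)"
  \<comment> \<open>The rejection probability on the sample \<open>U\<close> when the function is
    drawn from \<open>p\<close>.\<close>
  define G where "G p U = measure_pmf.expectation (A U) (\<lambda>t. measure p {f. run t f = False})"
    for p :: "boolfun pmf" and U
  let ?S = "pmf_of_set (samples n u)"
  have set_no: "set_pmf no = boolfuns n" by (simp add: no_def)
  have set_S: "set_pmf ?S = samples n u" using samples_nonempty u by simp
  have G01: "0 \<le> G p U" "G p U \<le> 1" for p U
    unfolding G_def by (auto intro!: integral_nonneg measure_pmf.integral_le_const integrable_pmf_bounded[where B = 1])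
  have int: "integrable ?S (\<lambda>U. G p U)" for p
    using G01 by (intro integrable_pmf_bounded[where B = 1]) (simp add: abs_le_iff)
  have int_hits: "integrable ?S (indicator {U. hits n q Y U} :: _ \<Rightarrow> real)"
    by (intro integrable_pmf_bounded[where B = 1]) (auto simp: indicator_def)
  have pmf_G: "pmf (bind_pmf p (outcome n u A)) False = measure_pmf.expectation ?S (\<lambda>U. G p U)" for p
    unfolding G_def by (rule pmf_bind_outcome)
  have Y: "Y \<subseteq> cube n" by (auto simp: Y_def)

  \<comment> \<open>Union bound over the \<open>k\<close> blocks, with the two-sided tail bound on
    each.\<close>
  have "real (card Y) \<le> (\<Sum>j<k. real (card {y \<in> cube n. t * m \<le> \<bar>\<Sum>i\<in>block m j. chi (y i)\<bar>}))"
  proof -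
    have "Y = (\<Union>j<k. {y \<in> cube n. t * m \<le> \<bar>\<Sum>i\<in>block m j. chi (y i)\<bar>})" by (auto simp: Y_def)
    then show ?thesis
      using card_UN_le[of "{..<k}" "\<lambda>j. {y \<in> cube n. t * m \<le> \<bar>\<Sum>i\<in>block m j. chi (y i)\<bar>}"]
      by (simp flip: of_nat_sum)
  qed
  also have "\<dots> \<le> (\<Sum>j<k. 2 * 2 ^ n * exp (- (t\<^sup>2 * m / 4)))"
  proof (rule sum_mono)
    fix j assume "j \<in> {..<k}"
    then show "real (card {y \<in> cube n. t * m \<le> \<bar>\<Sum>i\<in>block m j. chi (y i)\<bar>})
        \<le> 2 * 2 ^ n * exp (- (t\<^sup>2 * m / 4))"
      using card_PiE_bit_abs_sum_ge[of "{0..<n}" "block m j" t] block_subset[OF _ m(1)] t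
      by (simp add: cube_def)
  qed
  finally have "real (card Y) / 2 ^ n \<le> 2 * k * exp (- (t\<^sup>2 * m / 4))"
    by (simp add: field_simps)
  then have "(2 * real u ^ (q + 1)) * (real (card Y) / 2 ^ n)
      \<le> (2 * real u ^ (q + 1)) * (2 * k * exp (- (t\<^sup>2 * m / 4)))"
    by (intro mult_left_mono) auto
  also have "\<dots> \<le> 1 / 20" using bad by (simp add: mult_ac)
  finally have hits: "measure ?S {U. hits n q Y U} \<le> 1 / 20"
    using prob_hits_le[OF Y u, of q] by (simp only: times_divide_eq_right)

  \<comment> \<open>On a bad sample the subtracted indicator makes the left side negative, so only
    samples that are not hit need the comparison of trees.\<close>
  have yes_no: "3 / 4 * G no U - indicator {U. hits n q Y U} U \<le> G (yes n m k) U"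
    if U: "U \<in> samples n u" for U
  proof (cases "hits n q Y U")
    case True
    then show ?thesis using G01[of no U] G01[of "yes n m k" U] by simp
  next
    case False
    have "3 / 4 * G no U = measure_pmf.expectation (A U) (\<lambda>t. 3 / 4 * measure no {f. run t f = False})"
      by (simp add: G_def)
    also have "\<dots> \<le> G (yes n m k) U"
      unfolding G_def
    proof (rule integral_mono_AE)
      show "AE r in A U. 3 / 4 * measure no {f. run r f = False} \<le> measure (yes n m k) {f. run r f = False}"
        unfolding no_def
        using False U m t tester
        by (intro AE_pmfI yes_ge_uniform[where U = U and q = q and t = t])
          (auto simp: Y_def samples_def is_tester_def)
      show "integrable (A U) (\<lambda>t. 3 / 4 * measure no {f. run t f = False})"
        by (intro integrable_pmf_bounded[where B = 1])
          (auto simp: abs_mult intro: order_trans[OF mult_left_mono[OF measure_pmf.prob_le_1]])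
      show "integrable (A U) (\<lambda>t. measure (yes n m k) {f. run t f = False})"
        by (intro integrable_pmf_bounded[where B = 1]) auto
    qed
    finally show ?thesis using False by simp
  qed

  have "3 / 4 * pmf (bind_pmf no (outcome n u A)) False - measure ?S {U. hits n q Y U}
      = measure_pmf.expectation ?S (\<lambda>U. 3 / 4 * G no U - indicator {U. hits n q Y U} U)"
    using int int_hits by (simp add: pmf_G)
  also have "\<dots> \<le> measure_pmf.expectation ?S (\<lambda>U. G (yes n m k) U)"
    using yes_no set_S
    by (intro integral_mono_AE AE_pmfI Bochner_Integration.integrable_diff integrable_mult_right int int_hits) auto
  also have "\<dots> = pmf (bind_pmf (yes n m k) (outcome n u A)) False"
    by (simp add: pmf_G)
  also have "\<dots> \<le> 1 / 3"
  proof -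
    have "pmf (outcome n u A f) False \<le> 1 / 3" if "f \<in> set_pmf (yes n m k)" for f
    proof -
      have "f \<in> Lin n k"
        using that lin_in_Lin[OF _ m(1)] transversals_nonempty[OF m(2)] by (auto simp: yes_def)
      then have "2 / 3 \<le> pmf (outcome n u A f) True"
        using tester Lin_subset_boolfuns[of n k] unfolding is_tester_def by blast
      then show ?thesis by (simp add: pmf_False_conv_True)
    qed
    then show ?thesis
      unfolding pmf_bind
      by (intro measure_pmf.integral_le_const integrable_pmf_bounded[where B = 1] AE_pmfI)
        (auto simp: pmf_le_1)
  qed
  finally have upper: "3 / 4 * pmf (bind_pmf no (outcome n u A)) False - measure ?S {U. hits n q Y U} \<le> 1 / 3" .

  \<comment> \<open>Functions that are not far count as 0 on the left.\<close>
  have "2 / 3 * measure no {f. far n \<epsilon> (Lin n k) f}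
      = measure_pmf.expectation no (\<lambda>f. 2 / 3 * indicator {f. far n \<epsilon> (Lin n k) f} f)"
    by simp
  also have "\<dots> \<le> pmf (bind_pmf no (outcome n u A)) False"
    unfolding pmf_bind
  proof (rule integral_mono_AE)
    show "AE f in no. 2 / 3 * indicator {f. far n \<epsilon> (Lin n k) f} f \<le> pmf (outcome n u A f) False"
      using tester set_no by (intro AE_pmfI) (auto simp: is_tester_def indicator_def)
  qed (auto intro!: integrable_pmf_bounded[where B = 1] simp: pmf_le_1 indicator_def)
  finally have "2 / 3 * measure no {f. far n \<epsilon> (Lin n k) f} \<le> pmf (bind_pmf no (outcome n u A)) False" .
  moreover have "1 - 1 / 20 \<le> measure no {f. far n \<epsilon> (Lin n k) f}"
    unfolding no_def by (rule order_trans[OF diff_left_mono[OF far] prob_far_Lin_ge[OF \<epsilon>]])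
  \<comment> \<open>Numerically, \<open>3/4 * 2/3 * 19/20 - 1/20 = 0.425\<close>, which exceeds
    \<open>1/3\<close>.\<close>
  moreover have "x \<le> 1 / 20 \<Longrightarrow> 3 / 4 * y - x \<le> 1 / 3 \<Longrightarrow> 2 / 3 * z \<le> y \<Longrightarrow> 1 - 1 / 20 \<le> z \<Longrightarrow> False"
    for x y z :: real by linarith
  ultimately show False using upper hits by blast
qed

section \<open>Query complexity and choice of parameters\<close>

text \<open>The infimum lives in \<open>enat\<close>, so the real bound is first rounded up to a
  natural number.\<close>

lemma le_Qa:
  assumes "\<And>q A. is_tester n \<epsilon> P u q A \<Longrightarrow> x \<le> real q"
  shows "ereal x \<le> ereal_of_enat (Qa n \<epsilon> P u)"
proof -
  have "enat (nat \<lceil>x\<rceil>) \<le> Qa n \<epsilon> P u"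
    unfolding Qa_def using assms by (intro INF_greatest) (auto simp: ceiling_le_iff)
  then have "ereal_of_enat (enat (nat \<lceil>x\<rceil>)) \<le> ereal_of_enat (Qa n \<epsilon> P u)"
    by (simp only: ereal_of_enat_le_iff)
  moreover have "ereal x \<le> ereal_of_enat (enat (nat \<lceil>x\<rceil>))"
    by (simp add: real_nat_ceiling_ge)
  ultimately show ?thesis by (rule order_trans[rotated])
qed

theorem theorem13:
  fixes \<epsilon> :: real
  assumes "0 < \<epsilon>" and "\<epsilon> \<le> 1 / 1000"
  shows "\<exists>c::real>0. \<forall>\<^sub>F n::nat in sequentially. \<forall>k\<in>{1..n}. \<forall>u::nat.
           n \<le> u \<longrightarrow> real u \<le> exp (real n powr (1 / (7 * real k))) \<longrightarrow>
           ereal (c * (real k * log 2 (real n))) \<le> ereal_of_enat (Qa n \<epsilon> (Lin n k) u)"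
proof (intro exI[of _ "1 / 8"] conjI)
  \<comment> \<open>The failure bound at its worst values \<open>k = ln n\<close>,
    \<open>u = exp (n powr (1/7))\<close>, \<open>m = n / ln n - 1\<close>, hence uniform in
    \<open>k\<close> and \<open>u\<close>. In the exponent, \<open>n powr (1/7)\<close> times
    squared logarithms loses to \<open>n powr (3/4)\<close> over a logarithm.\<close>
  have "\<forall>\<^sub>F n::nat in sequentially. 4 * ln (real n) *
      exp ((ln (real n) * log 2 (real n) / 8 + 1) * real n powr (1 / 7)
           - real n powr (- 1 / 4) / 64 * (real n / ln (real n) - 1)) \<le> 1 / 20"
    by real_asymp
  moreover have "\<forall>\<^sub>F n::nat in sequentially. 2 * exp (real n powr (1 / 7)) \<le> 2 ^ n"
    by real_asymp
  moreover have "\<forall>\<^sub>F n::nat in sequentially. 2 ^ n * exp (- (2 ^ n / 5)) \<le> (1 / 20 :: real)"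
    by real_asymp
  moreover have "\<forall>\<^sub>F n::nat in sequentially. 1 \<le> ln (ln (real n))"
    by real_asymp
  moreover have "\<forall>\<^sub>F n::nat in sequentially. 3 \<le> n"
    by (rule eventually_ge_at_top)
  ultimately show "\<forall>\<^sub>F n::nat in sequentially. \<forall>k\<in>{1..n}. \<forall>u::nat.
           n \<le> u \<longrightarrow> real u \<le> exp (real n powr (1 / (7 * real k))) \<longrightarrow>
           ereal (1 / 8 * (real k * log 2 (real n))) \<le> ereal_of_enat (Qa n \<epsilon> (Lin n k) u)"
  proof eventually_elim
    case (elim n)
    show ?case
    proof (intro ballI allI impI le_Qa)
      fix k u q :: nat and A
      assume k: "k \<in> {1..n}" and u: "n \<le> u" "real u \<le> exp (real n powr (1 / (7 * real k)))"
        and tester: "is_tester n \<epsilon> (Lin n k) u q A"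
      define L where "L = ln (real n)"
      define m where "m = n div k"
      \<comment> \<open>The power of \<open>n\<close> cancels
        \<open>2 ^ q \<le> n powr (k / 8)\<close>; the divisor 4 leaves
        \<open>(1 / 4) ^ k \<le> 1 / 4\<close>.\<close>
      define t where "t = real n powr (- 1 / 8) / 4"
      have n: "3 \<le> n" "real n > 0" using elim by auto
      have L: "L > 1"
      proof -
        have "0 < L" using n by (simp add: L_def)
        moreover have "\<not> ln L \<le> 0" using elim(4) unfolding L_def by linarith
        ultimately show ?thesis by (simp add: ln_le_zero_iff)
      qed
      \<comment> \<open>Two logarithms of \<open>n \<le> u \<le> exp (n powr (1 / (7 * k)))\<close>
        give \<open>ln L \<le> L / (7 * k)\<close>, and \<open>ln L \<ge> 1\<close>. For larger
        \<open>k\<close> the range of \<open>u\<close> is empty.\<close>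
      have k_le: "real k \<le> L"
      proof -
        have "real n \<le> exp (real n powr (1 / (7 * real k)))" using u by linarith
        then have "L \<le> real n powr (1 / (7 * real k))"
          using n unfolding L_def by (metis ln_exp ln_mono)
        then have "ln L \<le> ln (real n powr (1 / (7 * real k)))" using L by (intro ln_mono) auto
        also have "\<dots> = L / (7 * real k)" using n by (simp add: L_def ln_powr)
        finally have "1 \<le> L / (7 * real k)" using elim by (simp add: L_def)
        then show ?thesis using k by (simp add: field_simps)
      qed
      show "1 / 8 * (real k * log 2 (real n)) \<le> real q"
      proof (rule ccontr)
        assume "\<not> 1 / 8 * (real k * log 2 (real n)) \<le> real q"
        then have q: "real q \<le> real k * log 2 (real n) / 8" by simp
        have u7: "real u \<le> exp (real n powr (1 / 7))"
        proof -
          have "real n powr (1 / (7 * real k)) \<le> real n powr (1 / 7)"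
            using k n by (intro powr_mono) (auto simp: field_simps)
          then show ?thesis using u by (meson exp_le_cancel_iff order_trans)
        qed
        show False
        proof (rule no_tester[OF tester assms(2), where m = m and t = t])
          show "k * m \<le> n" by (simp add: m_def)
          show "m > 0" using k by (simp add: m_def div_greater_zero_iff)
          show "u > 0" using u n by simp
          have "2 * real u \<le> 2 ^ n" using u7 elim by linarith
          then show "2 * u \<le> 2 ^ n" by (simp flip: of_nat_le_iff[where ?'a = real])
          show "0 \<le> t" by (simp add: t_def)
          have "real n powr (- 1 / 8) \<le> real n powr 0" using n by (intro powr_mono) auto
          then show "t \<le> 1" using n by (simp add: t_def)
          show "2 ^ n * exp (- (2 ^ n / 5)) \<le> (1 / 20 :: real)" using elim by simp
          show "2 ^ q * t ^ k \<le> 1 / 4"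
          proof -
            have "2 ^ q = 2 powr real q" by (simp add: powr_realpow)
            also have "\<dots> \<le> 2 powr (log 2 (real n) * (real k / 8))"
              using q by (intro powr_mono) (auto simp: mult_ac)
            also have "\<dots> = real n powr (1 / 8 * real k)"
              using n by (simp add: powr_powr [symmetric] del: times_divide_eq_right)
            also have "\<dots> = (real n powr (1 / 8)) ^ k"
              using n by (simp add: powr_power)
            finally have "2 ^ q * t ^ k \<le> (real n powr (1 / 8)) ^ k * t ^ k"
              by (intro mult_right_mono) (auto simp: t_def)
            also have "\<dots> = (1 / 4) ^ k"
              using n by (simp add: t_def power_mult_distrib [symmetric] powr_add [symmetric])
            also have "\<dots> \<le> (1 / 4) ^ 1" using k by (intro power_decreasing) auto
            finally show ?thesis by simp
          qed
          show "4 * real k * real u ^ (q + 1) * exp (- (t\<^sup>2 * m / 4)) \<le> 1 / 20"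
          proof -
            have "real u ^ (q + 1) \<le> exp (real n powr (1 / 7)) ^ (q + 1)"
              using u7 by (intro power_mono) auto
            also have "\<dots> = exp ((real q + 1) * real n powr (1 / 7))"
              by (simp add: exp_of_nat_mult [symmetric] exp_add [symmetric] algebra_simps)
            also have "\<dots> \<le> exp ((L * log 2 (real n) / 8 + 1) * real n powr (1 / 7))"
            proof -
              have "real k * log 2 (real n) \<le> L * log 2 (real n)"
                using k_le n by (intro mult_right_mono) auto
              then show ?thesis using q by (auto intro!: mult_right_mono)
            qed
            finally have 1: "real u ^ (q + 1) \<le> exp ((L * log 2 (real n) / 8 + 1) * real n powr (1 / 7))" .
            \<comment> \<open>\<open>m\<close> is \<open>n / k\<close> rounded down, so it loses
              less than 1.\<close>
            have "real n / L - 1 \<le> real n / real k - 1"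
              using k_le k by (auto intro!: divide_left_mono)
            also have "\<dots> \<le> real m"
            proof -
              have "n < k + m * k" unfolding m_def using k by (intro dividend_less_div_times) auto
              then have "real n < (1 + real m) * real k"
                by (simp add: algebra_simps flip: of_nat_mult of_nat_add)
              then show ?thesis using k by (simp add: field_simps)
            qed
            finally have "real n powr (- 1 / 4) / 64 * (real n / L - 1) \<le> real n powr (- 1 / 4) / 64 * real m"
              by (intro mult_left_mono) auto
            also have "\<dots> = t\<^sup>2 * m / 4"
              by (simp add: t_def power2_eq_square powr_add [symmetric])
            finally have 2: "exp (- (t\<^sup>2 * m / 4)) \<le> exp (- (real n powr (- 1 / 4) / 64 * (real n / L - 1)))"
              by simp
            have "4 * real k * real u ^ (q + 1) * exp (- (t\<^sup>2 * m / 4)) \<le>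
                4 * L * exp ((L * log 2 (real n) / 8 + 1) * real n powr (1 / 7))
                  * exp (- (real n powr (- 1 / 4) / 64 * (real n / L - 1)))"
              using 1 2 k_le L by (intro mult_mono) auto
            also have "\<dots> = 4 * L * exp ((L * log 2 (real n) / 8 + 1) * real n powr (1 / 7)
                - real n powr (- 1 / 4) / 64 * (real n / L - 1))"
              by (simp only: mult.assoc exp_add [symmetric] diff_conv_add_uminus)
            also have "\<dots> \<le> 1 / 20"
              using elim(1) unfolding L_def .
            finally show ?thesis .
          qed
        qed
      qed
    qed
  qed
qed simp

end
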